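(* Let $u\in F_{USC}(\mathbb{R}^m)$, and let $u(\cdot):[0,1]\to(C(\mathbb{R}^m)\cup\{\emptyset\},\tau_f)$ be the function defined by $u(\alpha)=[u]_\alpha$. Suppose that $\alpha\in(0,1)$. Then the following statements are true. (i) $\lim_{\beta\to\alpha+}[u]_\beta\,(K)=\overline{\{u>\alpha\}}$. (ii) $u(\cdot)$ is left-continuous at $\alpha$, i.e. $\lim_{\beta\to\alpha-}[u]_\beta\,(K)=[u]_\alpha$. (iii) $\alpha\in P(u)$ if and only if $\alpha$ is a discontinuous point of the function $u(\cdot)$.
   Context: A fuzzy set on $\mathbb{R}^m$ is a function $u:\mathbb{R}^m\to[0,1]$; $F_{USC}(\mathbb{R}^m)$ is the set of all upper semi-continuous ones. For $\alpha\in(0,1]$, $[u]_\alpha=\{x:u(x)\ge\alpha\}$; $[u]_0=\overline{\{x:u(x)>0\}}$; $\{u>\alpha\}=\{x:u(x)>\alpha\}$. $P(u)$ is the set of platform points of $u$: those $\alpha\in(0,1)$ with $\overline{\{u>\alpha\}}\subsetneqq[u]_\alpha$. $C(\mathbb{R}^m)$ is the set of all nonempty closed subsets of $\mathbb{R}^m$. $\tau_f$ is the Fell topology on $C(\mathbb{R}^m)\cup\{\emptyset\}$, generated by the sets $\{F:F\cap K=\emptyset\}$ ($K$ compact) and $\{F:F\cap G\neq\emptyset\}$ ($G$ open); it is metrizable and its convergent sequences are exactly the Kuratowski convergent ones. Kuratowski convergence: for sets $C_n\subseteq\mathbb{R}^m$, $\liminf_n C_n$ is the set of $x=\lim_n x_n$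 with $x_n\in C_n$ for all sufficiently large $n$, and $\limsup_n C_n$ is the set of $x=\lim_j x_{n_j}$ with $x_{n_j}\in C_{n_j}$ along some subsequence; $\lim_n C_n\,(K)=C$ means $C=\liminf_n C_n=\limsup_n C_n$. The notation $\lim_{\beta\to\alpha+}[u]_\beta\,(K)=B$ (resp. $\beta\to\alpha-$) means that $\lim_n[u]_{\beta_n}\,(K)=B$ for every sequence $\beta_n\to\alpha$ with $\beta_n>\alpha$ (resp. $\beta_n<\alpha$). *)

theory Defs
  imports "HOL-Analysis.Analysis"
begin

definition upper_semicontinuous :: "('a::topological_space \<Rightarrow> real) \<Rightarrow> bool" where
  "upper_semicontinuous u \<longleftrightarrow> (\<forall>x. \<forall>c>u x. \<forall>\<^sub>F y in at x. u y < c)"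

definition F_USC :: "(real ^ 'm \<Rightarrow> real) set" where
  "F_USC = {u. (\<forall>x. u x \<in> {0..1}) \<and> upper_semicontinuous u}"

text \<open>The level set of \<open>u\<close> at \<open>\<alpha>\<close>; only levels \<open>\<alpha>\<close> in the interval from 0 to 1 are meaningful.\<close>

definition alpha_cut :: "('a::topological_space \<Rightarrow> real) \<Rightarrow> real \<Rightarrow> 'a set" where
  "alpha_cut u \<alpha> = (if \<alpha> = 0 then closure {x. u x > 0} else {x. u x \<ge> \<alpha>})"

definition strict_cut :: "('a \<Rightarrow> real) \<Rightarrow> real \<Rightarrow> 'a set" where
  "strict_cut u \<alpha> = {x. u x > \<alpha>}"

definition platform_points :: "('a::topological_space \<Rightarrow> real) \<Rightarrow> real set" where
  "platform_points u = {\<alpha>. 0 < \<alpha> \<and> \<alpha> < 1 \<and> closure (strict_cut u \<alpha>) \<subset> alpha_cut u \<alpha>}"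

definition fell_topology :: "'a::topological_space set topology" where
  "fell_topology = topology_generated_by
     ({{F. closed F \<and> F \<inter> K = {}} |K. compact K} \<union> {{F. closed F \<and> F \<inter> G \<noteq> {}} |G. open G})"

lemma topspace_fell_topology: "topspace fell_topology = {F. closed F}"
proof -
  have "{F::'a set. closed F} \<in> {{F. closed F \<and> F \<inter> K = {}} |K. compact K}"
    by (auto intro!: exI[of _ "{}"])
  then show ?thesis
    unfolding fell_topology_def topology_generated_by_topspace by blast
qed

definition K_liminf :: "(nat \<Rightarrow> 'a::topological_space set) \<Rightarrow> 'a set" where
  "K_liminf C = {x. \<exists>\<xi>. (\<forall>\<^sub>F n in sequentially. \<xi> n \<in> C n) \<and> \<xi> \<longlonglongrightarrow> x}"

definition K_limsup :: "(nat \<Rightarrow> 'a::topological_space set) \<Rightarrow> 'a set" where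
  "K_limsup C = {x. \<exists>r \<xi>. strict_mono (r :: nat \<Rightarrow> nat) \<and> (\<forall>j. \<xi> j \<in> C (r j)) \<and> \<xi> \<longlonglongrightarrow> x}"

definition K_converges :: "(nat \<Rightarrow> 'a::topological_space set) \<Rightarrow> 'a set \<Rightarrow> bool" where
  "K_converges C L \<longleftrightarrow> L = K_liminf C \<and> L = K_limsup C"

text \<open>One-sided Kuratowski limits of the level sets; the sequences of levels range over the domain
  (the interval from 0 to 1) of the level set function.\<close>

definition alpha_cut_K_limit_right :: "('a::topological_space \<Rightarrow> real) \<Rightarrow> real \<Rightarrow> 'a set \<Rightarrow> bool" where
  "alpha_cut_K_limit_right u \<alpha> B \<longleftrightarrow>
     (\<forall>\<beta>. (\<forall>n. \<beta> n \<in> {0..1} \<and> \<beta> n > \<alpha>) \<and> \<beta> \<longlonglongrightarrow> \<alpha> \<longrightarrow> K_converges (\<lambda>n. alpha_cut u (\<beta> n)) B)"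

definition alpha_cut_K_limit_left :: "('a::topological_space \<Rightarrow> real) \<Rightarrow> real \<Rightarrow> 'a set \<Rightarrow> bool" where
  "alpha_cut_K_limit_left u \<alpha> B \<longleftrightarrow>
     (\<forall>\<beta>. (\<forall>n. \<beta> n \<in> {0..1} \<and> \<beta> n < \<alpha>) \<and> \<beta> \<longlonglongrightarrow> \<alpha> \<longrightarrow> K_converges (\<lambda>n. alpha_cut u (\<beta> n)) B)"

end

theory Submission
  imports Defs
begin

text \<open>
  Since the cuts decrease as the level grows, each of the two kinds of subbasic Fell neighbourhood
  of \<open>alpha_cut u \<alpha>\<close> gives trouble on one side of \<open>\<alpha>\<close> only. Missing a compact set can fail only at
  levels below \<open>\<alpha>\<close>, and meeting an open set can fail only at levels above \<open>\<alpha>\<close>.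

  Below \<open>\<alpha>\<close> nothing goes wrong: by upper semicontinuity the sets \<open>{x. u x < c}\<close> with \<open>c < \<alpha>\<close> form an
  increasing open cover of \<open>{x. u x < \<alpha>}\<close>, so a compact set missing the cut at \<open>\<alpha>\<close> already misses a
  cut at some lower level (\<open>compact_misses_lower_cut\<close>). The sequential form of this is that the cut
  at \<open>\<alpha>\<close> is the intersection of the closed cuts at lower positive levels.

  Above \<open>\<alpha>\<close> the cuts exhaust exactly the strict cut at \<open>\<alpha>\<close>. Therefore their Kuratowski limit is its
  closure, and an open set that meets the cut at \<open>\<alpha>\<close> keeps meeting the higher cuts near \<open>\<alpha>\<close> if and
  only if it meets the strict cut. So continuity at \<open>\<alpha>\<close> means that the closure of the strict cut is
  the whole cut (\<open>continuous_alpha_cut_iff\<close>), which is the negation of \<open>\<alpha>\<close> being a platform point.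
\<close>

section \<open>Continuity into the Fell topology\<close>

lemma openin_fell_miss: "compact K \<Longrightarrow> openin fell_topology {F. closed F \<and> F \<inter> K = {}}"
  unfolding fell_topology_def by (rule topology_generated_by_Basis) blast

lemma openin_fell_hit: "open G \<Longrightarrow> openin fell_topology {F. closed F \<and> F \<inter> G \<noteq> {}}"
  unfolding fell_topology_def by (rule topology_generated_by_Basis) blast

text \<open>Continuity at a point may be tested on a subbase: if it holds for each of some sets \<open>V\<close> that
  \<open>f\<close> maps a neighbourhood of \<open>x\<close> into \<open>V\<close> whenever \<open>f x \<in> V\<close>, then it also holds for their finite
  intersections and arbitrary unions.\<close>

lemma topcontinuous_at_fell_iff:
  "topcontinuous_at X fell_topology f x \<longleftrightarrow>
     x \<in> topspace X \<and> (\<forall>y\<in>topspace X. closed (f y)) \<and>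
     (\<forall>K. compact K \<and> f x \<inter> K = {} \<longrightarrow> (\<exists>U. openin X U \<and> x \<in> U \<and> (\<forall>y\<in>U. f y \<inter> K = {}))) \<and>
     (\<forall>G. open G \<and> f x \<inter> G \<noteq> {} \<longrightarrow> (\<exists>U. openin X U \<and> x \<in> U \<and> (\<forall>y\<in>U. f y \<inter> G \<noteq> {})))"
  (is "?lhs \<longleftrightarrow> ?x \<and> ?closed \<and> ?miss \<and> ?hit")
proof (rule iffI; (elim conjE)?)
  assume L: ?lhs
  then have x: ?x and cl: ?closed
    by (auto simp: topcontinuous_at_def topspace_fell_topology)
  have nbhd: "\<exists>U. openin X U \<and> x \<in> U \<and> (\<forall>y\<in>U. f y \<in> V)" if "openin fell_topology V" "f x \<in> V" for V
    using L that by (simp add: topcontinuous_at_def)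
  have ?miss
  proof (intro allI impI, elim conjE)
    fix K assume "compact K" "f x \<inter> K = {}"
    then show "\<exists>U. openin X U \<and> x \<in> U \<and> (\<forall>y\<in>U. f y \<inter> K = {})"
      using nbhd[OF openin_fell_miss, of K] x cl by simp blast
  qed
  moreover have ?hit
  proof (intro allI impI, elim conjE)
    fix G assume "open G" "f x \<inter> G \<noteq> {}"
    then show "\<exists>U. openin X U \<and> x \<in> U \<and> (\<forall>y\<in>U. f y \<inter> G \<noteq> {})"
      using nbhd[OF openin_fell_hit, of G] x cl by simp blast
  qed
  ultimately show "?x \<and> ?closed \<and> ?miss \<and> ?hit"
    using x cl by blast
next
  assume x: ?x and closed: ?closed and miss: ?miss and hit: ?hit
  have cl: "closed (f y)" if "openin X U" "y \<in> U" for y U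
    using closed openin_subset[OF that(1)] that(2) by blast
  have "f x \<in> V \<longrightarrow> (\<exists>U. openin X U \<and> x \<in> U \<and> (\<forall>y\<in>U. f y \<in> V))"
    if "openin fell_topology V" for V
    using that unfolding fell_topology_def openin_topology_generated_by_iff
  proof (induction rule: generate_topology_on.induct)
    case Empty
    then show ?case by simp
  next
    case (Int a b)
    show ?case
    proof
      assume "f x \<in> a \<inter> b"
      then obtain U V where "openin X U" "x \<in> U" "\<forall>y\<in>U. f y \<in> a"
        "openin X V" "x \<in> V" "\<forall>y\<in>V. f y \<in> b"
        using Int.IH by blast
      then show "\<exists>U. openin X U \<and> x \<in> U \<and> (\<forall>y\<in>U. f y \<in> a \<inter> b)"
        by (intro exI[of _ "U \<inter> V"]) auto
    qed
  next
    case (UN k)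
    then show ?case by (metis UnionE UnionI)
  next
    case (Basis s)
    then consider K where "compact K" "s = {F. closed F \<and> F \<inter> K = {}}"
      | G where "open G" "s = {F. closed F \<and> F \<inter> G \<noteq> {}}"
      by blast
    then show ?case
    proof cases
      case 1
      have "\<exists>U. openin X U \<and> x \<in> U \<and> (\<forall>y\<in>U. f y \<inter> K = {})" if "f x \<inter> K = {}"
        using miss \<open>compact K\<close> that by simp
      then show ?thesis unfolding 1(2) using cl by simp blast
    next
      case 2
      have "\<exists>U. openin X U \<and> x \<in> U \<and> (\<forall>y\<in>U. f y \<inter> G \<noteq> {})" if "f x \<inter> G \<noteq> {}"
        using hit \<open>open G\<close> that by simp
      then show ?thesis unfolding 2(2) using cl by simp blast
    qed
  qed
  then show ?lhs
    using x closed by (simp add: topcontinuous_at_def topspace_fell_topology)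
qed

section \<open>Cuts of upper semicontinuous functions\<close>

lemma open_sublevel:
  assumes "upper_semicontinuous u"
  shows "open {x. u x < c}"
proof (subst open_subopen, intro ballI)
  fix x assume "x \<in> {x. u x < c}"
  then have "u x < c" "\<forall>\<^sub>F y in at x. u y < c"
    using assms by (auto simp: upper_semicontinuous_def)
  then have "\<forall>\<^sub>F y in nhds x. u y < c"
    by (simp add: eventually_nhds_conv_at)
  then show "\<exists>T. open T \<and> x \<in> T \<and> T \<subseteq> {x. u x < c}"
    unfolding eventually_nhds by blast
qed

lemma closed_alpha_cut:
  assumes "upper_semicontinuous u"
  shows "closed (alpha_cut u \<beta>)"
proof -
  have "{x. u x \<ge> \<beta>} = - {x. u x < \<beta>}" by auto
  then show ?thesis
    using open_sublevel[OF assms] by (simp add: alpha_cut_def closed_Compl)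
qed

lemma alpha_cut_pos: "0 < \<beta> \<Longrightarrow> alpha_cut u \<beta> = {x. u x \<ge> \<beta>}"
  by (simp add: alpha_cut_def)

lemma alpha_cut_antimono:
  assumes "0 \<le> \<beta>" "\<beta> \<le> \<gamma>"
  shows "alpha_cut u \<gamma> \<subseteq> alpha_cut u \<beta>"
proof (cases "\<beta> = 0 \<and> \<gamma> \<noteq> 0")
  case True
  then have "alpha_cut u \<gamma> \<subseteq> {x. u x > 0}"
    using assms by (auto simp: alpha_cut_def)
  then show ?thesis
    using True closure_subset[of "{x. u x > 0}"] by (auto simp: alpha_cut_def)
next
  case False
  then show ?thesis
    using assms by (auto simp: alpha_cut_def)
qed

lemma alpha_cut_subset_strict_cut:
  assumes "0 \<le> \<alpha>" "\<alpha> < \<beta>"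
  shows "alpha_cut u \<beta> \<subseteq> strict_cut u \<alpha>"
  using assms by (auto simp: alpha_cut_def strict_cut_def)

lemma closure_strict_cut_subset:
  assumes "upper_semicontinuous u" "0 < \<alpha>"
  shows "closure (strict_cut u \<alpha>) \<subseteq> alpha_cut u \<alpha>"
  using assms(2) by (intro closure_minimal closed_alpha_cut[OF assms(1)])
    (auto simp: alpha_cut_def strict_cut_def)

text \<open>The sets \<open>{x. u x < c}\<close> with \<open>0 < c < \<alpha>\<close> are an open cover of \<open>K\<close> that is totally ordered by
  inclusion, so a single one of them contains \<open>K\<close>.\<close>

lemma compact_misses_lower_cut:
  assumes u: "upper_semicontinuous u" and "0 < \<alpha>" and K: "compact K"
    and miss: "alpha_cut u \<alpha> \<inter> K = {}"
  obtains c where "0 < c" "c < \<alpha>" "\<And>\<beta>. c \<le> \<beta> \<Longrightarrow> alpha_cut u \<beta> \<inter> K = {}"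
proof -
  have "K \<subseteq> (\<Union>c\<in>{0<..<\<alpha>}. {x. u x < c})"
  proof
    fix x assume "x \<in> K"
    then have "max 0 (u x) < \<alpha>"
      using miss \<open>0 < \<alpha>\<close> by (auto simp: alpha_cut_pos disjoint_iff not_le)
    then obtain c where "max 0 (u x) < c" "c < \<alpha>"
      using dense by blast
    then show "x \<in> (\<Union>c\<in>{0<..<\<alpha>}. {x. u x < c})" by auto
  qed
  then obtain D where D: "D \<subseteq> {0<..<\<alpha>}" "finite D" "K \<subseteq> (\<Union>c\<in>D. {x. u x < c})"
    using compactE_image[OF K, of "{0<..<\<alpha>}" "\<lambda>c. {x. u x < c}"] open_sublevel[OF u] by metis
  \<comment> \<open>Inserting a level makes the finite set nonempty, which is needed when \<open>K\<close> is empty.\<close>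
  define c where "c = Max (insert (\<alpha> / 2) D)"
  have "c \<in> insert (\<alpha> / 2) D"
    unfolding c_def using D(2) by (intro Max_in) auto
  then have c: "0 < c" "c < \<alpha>"
    using D(1) \<open>0 < \<alpha>\<close> by auto
  have "d \<le> c" if "d \<in> D" for d
    unfolding c_def using D(2) that by simp
  then have "alpha_cut u \<beta> \<inter> K = {}" if "c \<le> \<beta>" for \<beta>
    using D(3) c that by (force simp: alpha_cut_pos)
  with c that show thesis by blast
qed

section \<open>Kuratowski limits of the cuts\<close>

text \<open>Approximating sequences with error \<open>e\<close> for each \<open>e\<close> merge into one convergent sequence, by
  picking points whose distance to \<open>x\<close> exceeds the distance of the sets to \<open>x\<close> by less than \<open>1/(n+1)\<close>.\<close>

lemma mem_K_liminfI:
  fixes x :: "'a::metric_space"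
  assumes near: "\<And>e. e > 0 \<Longrightarrow> \<forall>\<^sub>F n in sequentially. \<exists>y\<in>C n. dist x y < e"
  shows "x \<in> K_liminf C"
proof -
  define \<xi> where "\<xi> n = (SOME y. y \<in> C n \<and> dist x y < infdist x (C n) + inverse (real (Suc n)))" for n
  have \<xi>: "\<xi> n \<in> C n \<and> dist x (\<xi> n) < infdist x (C n) + inverse (real (Suc n))"
    if "C n \<noteq> {}" for n
  proof -
    have "\<exists>y\<in>C n. dist x y < infdist x (C n) + inverse (real (Suc n))"
      using that cINF_less_iff[of "C n" "dist x" "infdist x (C n) + inverse (real (Suc n))"]
      by (simp add: infdist_notempty bdd_below_image_dist)
    then show ?thesis
      unfolding \<xi>_def by (metis (mono_tags, lifting) someI_ex)
  qed
  have nonempty: "\<forall>\<^sub>F n in sequentially. C n \<noteq> {}"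
    using near[OF zero_less_one] by eventually_elim auto
  have "\<xi> \<longlonglongrightarrow> x"
  proof (rule tendstoI)
    fix e :: real assume "0 < e"
    have "\<forall>\<^sub>F n in sequentially. inverse (real (Suc n)) < e / 2"
      using order_tendstoD(2)[OF LIMSEQ_inverse_real_of_nat, of "e / 2"] \<open>0 < e\<close> by simp
    moreover have "\<forall>\<^sub>F n in sequentially. \<exists>y\<in>C n. dist x y < e / 2"
      by (rule near) (use \<open>0 < e\<close> in simp)
    ultimately show "\<forall>\<^sub>F n in sequentially. dist (\<xi> n) x < e"
    proof eventually_elim
      case (elim n)
      then obtain y where "y \<in> C n" "dist x y < e / 2" by blast
      then show ?case
        using \<xi>[of n] infdist_le[of y "C n" x] elim(1) by (force simp: dist_commute)
    qed
  qed
  moreover have "\<forall>\<^sub>F n in sequentially. \<xi> n \<in> C n"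
    using nonempty by eventually_elim (use \<xi> in blast)
  ultimately show ?thesis
    unfolding K_liminf_def by blast
qed

lemma K_limsup_subset_closed:
  assumes "closed F" "\<forall>\<^sub>F n in sequentially. C n \<subseteq> F"
  shows "K_limsup C \<subseteq> F"
proof
  fix x assume "x \<in> K_limsup C"
  then obtain r \<xi> where r: "strict_mono (r :: nat \<Rightarrow> nat)" and "\<And>j. \<xi> j \<in> C (r j)" and "\<xi> \<longlonglongrightarrow> x"
    unfolding K_limsup_def by blast
  moreover have "\<forall>\<^sub>F j in sequentially. C (r j) \<subseteq> F"
    using assms(2) filterlim_subseq[OF r] by (rule eventually_compose_filterlim)
  then have "\<forall>\<^sub>F j in sequentially. \<xi> j \<in> F"
    by eventually_elim (use \<open>\<And>j. \<xi> j \<in> C (r j)\<close> in blast)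
  ultimately show "x \<in> F"
    using Lim_in_closed_set[OF assms(1)] by (metis trivial_limit_sequentially)
qed

lemma K_liminf_subset_K_limsup: "K_liminf C \<subseteq> K_limsup C"
proof
  fix x assume "x \<in> K_liminf C"
  then obtain \<xi> N where "\<forall>n\<ge>N. \<xi> n \<in> C n" and lim: "\<xi> \<longlonglongrightarrow> x"
    unfolding K_liminf_def eventually_sequentially by blast
  then have "strict_mono (\<lambda>j. j + N)" "\<forall>j. \<xi> (j + N) \<in> C (j + N)"
    "(\<lambda>j. \<xi> (j + N)) \<longlonglongrightarrow> x"
    by (auto simp: strict_mono_def intro: LIMSEQ_ignore_initial_segment)
  then show "x \<in> K_limsup C"
    unfolding K_limsup_def
    by (intro CollectI exI[of _ "\<lambda>j. j + N"] exI[of _ "\<lambda>j. \<xi> (j + N)"] conjI)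
qed

lemma K_convergesI:
  assumes "L \<subseteq> K_liminf C" "K_limsup C \<subseteq> L"
  shows "K_converges C L"
  using assms K_liminf_subset_K_limsup[of C] unfolding K_converges_def by blast

text \<open>The higher cuts lie in the strict cut, and each point of the strict cut lies in all cuts at
  levels close enough to \<open>\<alpha>\<close>. A Kuratowski lower limit is closed, whence the closure.\<close>

lemma alpha_cut_K_limit_right:
  fixes u :: "'a::metric_space \<Rightarrow> real"
  assumes "0 \<le> \<alpha>"
  shows "alpha_cut_K_limit_right u \<alpha> (closure (strict_cut u \<alpha>))"
  unfolding alpha_cut_K_limit_right_def
proof (intro allI impI, elim conjE)
  fix \<beta> :: "nat \<Rightarrow> real"
  assume \<beta>: "\<forall>n. \<beta> n \<in> {0..1} \<and> \<beta> n > \<alpha>" and lim: "\<beta> \<longlonglongrightarrow> \<alpha>"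
  show "K_converges (\<lambda>n. alpha_cut u (\<beta> n)) (closure (strict_cut u \<alpha>))"
  proof (rule K_convergesI)
    show "closure (strict_cut u \<alpha>) \<subseteq> K_liminf (\<lambda>n. alpha_cut u (\<beta> n))"
    proof (intro subsetI mem_K_liminfI)
      fix x and e :: real assume "x \<in> closure (strict_cut u \<alpha>)" "e > 0"
      then obtain y where "u y > \<alpha>" "dist x y < e"
        by (auto simp: closure_approachable strict_cut_def dist_commute)
      have "\<forall>\<^sub>F n in sequentially. \<beta> n < u y"
        using order_tendstoD(2)[OF lim \<open>u y > \<alpha>\<close>] .
      then show "\<forall>\<^sub>F n in sequentially. \<exists>y\<in>alpha_cut u (\<beta> n). dist x y < e"
      proof eventually_elim
        case (elim n)
        moreover have "0 < \<beta> n"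
          using \<beta> assms by (meson order_le_less_trans)
        ultimately have "y \<in> alpha_cut u (\<beta> n)" by (simp add: alpha_cut_pos)
        then show ?case using \<open>dist x y < e\<close> by blast
      qed
    qed
    have "alpha_cut u (\<beta> n) \<subseteq> closure (strict_cut u \<alpha>)" for n
      using alpha_cut_subset_strict_cut[OF assms] \<beta> closure_subset by fast
    then show "K_limsup (\<lambda>n. alpha_cut u (\<beta> n)) \<subseteq> closure (strict_cut u \<alpha>)"
      by (intro K_limsup_subset_closed) auto
  qed
qed

text \<open>Each closed cut at a positive level \<open>c < \<alpha>\<close> eventually contains the cuts in the sequence, so it
  contains their upper limit; the intersection of these cuts is the cut at \<open>\<alpha>\<close>.\<close>

lemma alpha_cut_K_limit_left:
  assumes u: "upper_semicontinuous u" and "0 < \<alpha>"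
  shows "alpha_cut_K_limit_left u \<alpha> (alpha_cut u \<alpha>)"
  unfolding alpha_cut_K_limit_left_def
proof (intro allI impI, elim conjE)
  fix \<beta> :: "nat \<Rightarrow> real"
  assume \<beta>: "\<forall>n. \<beta> n \<in> {0..1} \<and> \<beta> n < \<alpha>" and lim: "\<beta> \<longlonglongrightarrow> \<alpha>"
  show "K_converges (\<lambda>n. alpha_cut u (\<beta> n)) (alpha_cut u \<alpha>)"
  proof (rule K_convergesI)
    have "alpha_cut u \<alpha> \<subseteq> alpha_cut u (\<beta> n)" for n
      using \<beta> by (intro alpha_cut_antimono) (auto simp: less_imp_le)
    then have "\<forall>\<^sub>F n in sequentially. x \<in> alpha_cut u (\<beta> n)" if "x \<in> alpha_cut u \<alpha>" for x
      using that by (intro always_eventually) blast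
    then have "\<forall>\<^sub>F n in sequentially. (\<lambda>_. x) n \<in> alpha_cut u (\<beta> n)" "(\<lambda>_. x) \<longlonglongrightarrow> x"
      if "x \<in> alpha_cut u \<alpha>" for x
      using that by simp_all
    then show "alpha_cut u \<alpha> \<subseteq> K_liminf (\<lambda>n. alpha_cut u (\<beta> n))"
      unfolding K_liminf_def by fast
    have "K_limsup (\<lambda>n. alpha_cut u (\<beta> n)) \<subseteq> alpha_cut u c" if "0 < c" "c < \<alpha>" for c
    proof (rule K_limsup_subset_closed[OF closed_alpha_cut[OF u]])
      show "\<forall>\<^sub>F n in sequentially. alpha_cut u (\<beta> n) \<subseteq> alpha_cut u c"
        using order_tendstoD(1)[OF lim \<open>c < \<alpha>\<close>]
        by eventually_elim (use \<open>0 < c\<close> in \<open>simp add: alpha_cut_antimono\<close>)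
    qed
    then have "c \<le> u x" if "x \<in> K_limsup (\<lambda>n. alpha_cut u (\<beta> n))" "0 < c" "c < \<alpha>" for x c
      using that by (auto simp: alpha_cut_pos)
    then show "K_limsup (\<lambda>n. alpha_cut u (\<beta> n)) \<subseteq> alpha_cut u \<alpha>"
      using \<open>0 < \<alpha>\<close> by (auto simp: alpha_cut_pos intro: dense_le_bounded)
  qed
qed

section \<open>Continuity of the cuts as a function of the level\<close>

text \<open>On \<open>{0..\<alpha>}\<close> all cuts contain the cut at \<open>\<alpha>\<close>, so only compact sets need an argument.\<close>

lemma left_continuous_alpha_cut:
  assumes u: "upper_semicontinuous u" and "0 < \<alpha>"
  shows "topcontinuous_at (top_of_set {0..\<alpha>}) fell_topology (alpha_cut u) \<alpha>"
  unfolding topcontinuous_at_fell_iff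
proof (intro conjI ballI allI impI; (elim conjE)?)
  show "\<alpha> \<in> topspace (top_of_set {0..\<alpha>})" using \<open>0 < \<alpha>\<close> by simp
  show "closed (alpha_cut u \<beta>)" for \<beta> by (rule closed_alpha_cut[OF u])
next
  fix K assume "compact K" "alpha_cut u \<alpha> \<inter> K = {}"
  then obtain c where c: "0 < c" "c < \<alpha>" "\<And>\<beta>. c \<le> \<beta> \<Longrightarrow> alpha_cut u \<beta> \<inter> K = {}"
    using compact_misses_lower_cut[OF u \<open>0 < \<alpha>\<close>] by blast
  then show "\<exists>U. openin (top_of_set {0..\<alpha>}) U \<and> \<alpha> \<in> U \<and> (\<forall>\<beta>\<in>U. alpha_cut u \<beta> \<inter> K = {})"
    using c by (intro exI[of _ "{0..\<alpha>} \<inter> {c<..}"]) (auto simp: openin_open_Int)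
next
  fix G assume "alpha_cut u \<alpha> \<inter> G \<noteq> {}"
  then have "\<forall>\<beta>\<in>{0..\<alpha>}. alpha_cut u \<beta> \<inter> G \<noteq> {}"
    using alpha_cut_antimono[of _ \<alpha> u] by fastforce
  then show "\<exists>U. openin (top_of_set {0..\<alpha>}) U \<and> \<alpha> \<in> U \<and> (\<forall>\<beta>\<in>U. alpha_cut u \<beta> \<inter> G \<noteq> {})"
    using \<open>0 < \<alpha>\<close> by (intro exI[of _ "{0..\<alpha>}"]) auto
qed

text \<open>The open set that detects a discontinuity is the complement of the closure of the strict cut:
  it meets no cut at a level above \<open>\<alpha>\<close>.\<close>

lemma continuous_alpha_cut_iff:
  assumes u: "upper_semicontinuous u" and "0 < \<alpha>" "\<alpha> < 1"
  shows "topcontinuous_at (top_of_set {0..1}) fell_topology (alpha_cut u) \<alpha>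
    \<longleftrightarrow> closure (strict_cut u \<alpha>) = alpha_cut u \<alpha>"
proof
  assume cont: "topcontinuous_at (top_of_set {0..1}) fell_topology (alpha_cut u) \<alpha>"
  show "closure (strict_cut u \<alpha>) = alpha_cut u \<alpha>"
  proof (rule ccontr)
    define G where "G = - closure (strict_cut u \<alpha>)"
    assume "closure (strict_cut u \<alpha>) \<noteq> alpha_cut u \<alpha>"
    then have "open G" "alpha_cut u \<alpha> \<inter> G \<noteq> {}"
      using closure_strict_cut_subset[OF u \<open>0 < \<alpha>\<close>] by (auto simp: G_def)
    then have "\<exists>U. openin (top_of_set {0..1}) U \<and> \<alpha> \<in> U \<and> (\<forall>\<beta>\<in>U. alpha_cut u \<beta> \<inter> G \<noteq> {})"
      using cont[unfolded topcontinuous_at_fell_iff, THEN conjunct2, THEN conjunct2, THEN conjunct2]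
      by simp
    then obtain U where U: "openin (top_of_set {0..1}) U" "\<alpha> \<in> U"
      "\<forall>\<beta>\<in>U. alpha_cut u \<beta> \<inter> G \<noteq> {}"
      by (elim exE conjE)
    then obtain e where e: "e > 0" "\<And>\<beta>. \<beta> \<in> {0..1} \<Longrightarrow> dist \<beta> \<alpha> < e \<Longrightarrow> \<beta> \<in> U"
      unfolding openin_euclidean_subtopology_iff by blast
    define \<beta> where "\<beta> = min 1 (\<alpha> + e / 2)"
    have "\<alpha> < \<beta>" "\<beta> \<in> U"
      using e assms by (auto simp: \<beta>_def dist_real_def intro!: e(2))
    then have "alpha_cut u \<beta> \<inter> G = {}"
      using alpha_cut_subset_strict_cut[of \<alpha> \<beta> u] \<open>0 < \<alpha>\<close> closure_subset[of "strict_cut u \<alpha>"]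
      by (auto simp: G_def)
    with U(3) \<open>\<beta> \<in> U\<close> show False by blast
  qed
next
  assume eq: "closure (strict_cut u \<alpha>) = alpha_cut u \<alpha>"
  show "topcontinuous_at (top_of_set {0..1}) fell_topology (alpha_cut u) \<alpha>"
    unfolding topcontinuous_at_fell_iff
  proof (intro conjI ballI allI impI; (elim conjE)?)
    show "\<alpha> \<in> topspace (top_of_set {0..1})" using assms by simp
    show "closed (alpha_cut u \<beta>)" for \<beta> by (rule closed_alpha_cut[OF u])
  next
    fix K assume "compact K" "alpha_cut u \<alpha> \<inter> K = {}"
    then obtain c where c: "0 < c" "c < \<alpha>" "\<And>\<beta>. c \<le> \<beta> \<Longrightarrow> alpha_cut u \<beta> \<inter> K = {}"
      using compact_misses_lower_cut[OF u \<open>0 < \<alpha>\<close>] by blast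
    then show "\<exists>U. openin (top_of_set {0..1}) U \<and> \<alpha> \<in> U \<and> (\<forall>\<beta>\<in>U. alpha_cut u \<beta> \<inter> K = {})"
      using c assms by (intro exI[of _ "{0..1} \<inter> {c<..}"]) (auto simp: openin_open_Int)
  next
    fix G assume "open G" "alpha_cut u \<alpha> \<inter> G \<noteq> {}"
    \<comment> \<open>An open set that meets a closure meets the set itself, and a point of the strict cut
        survives at all levels below its value.\<close>
    then obtain x where x: "x \<in> G" "\<alpha> < u x"
      using open_Int_closure_eq_empty[of G "strict_cut u \<alpha>"] eq by (auto simp: strict_cut_def)
    have "alpha_cut u \<beta> \<inter> G \<noteq> {}" if "0 \<le> \<beta>" "\<beta> < u x" for \<beta>
      using alpha_cut_antimono[of \<beta> "u x" u] that x assms by (auto simp: alpha_cut_pos)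
    then show "\<exists>U. openin (top_of_set {0..1}) U \<and> \<alpha> \<in> U \<and> (\<forall>\<beta>\<in>U. alpha_cut u \<beta> \<inter> G \<noteq> {})"
      using x assms by (intro exI[of _ "{0..1} \<inter> {..<u x}"]) (auto simp: openin_open_Int)
  qed
qed

theorem theorem5p3:
  fixes u :: "real ^ 'm \<Rightarrow> real" and \<alpha> :: real
  assumes "u \<in> F_USC" and "0 < \<alpha>" and "\<alpha> < 1"
  shows "alpha_cut_K_limit_right u \<alpha> (closure (strict_cut u \<alpha>))
    \<and> (topcontinuous_at (top_of_set {0..\<alpha>}) fell_topology (alpha_cut u) \<alpha>
        \<and> alpha_cut_K_limit_left u \<alpha> (alpha_cut u \<alpha>))
    \<and> (\<alpha> \<in> platform_points u \<longleftrightarrow>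
        \<not> topcontinuous_at (top_of_set {0..1}) fell_topology (alpha_cut u) \<alpha>)"
proof -
  have u: "upper_semicontinuous u"
    using assms(1) by (simp add: F_USC_def)
  have "\<alpha> \<in> platform_points u \<longleftrightarrow> closure (strict_cut u \<alpha>) \<noteq> alpha_cut u \<alpha>"
    using closure_strict_cut_subset[OF u assms(2)] assms by (auto simp: platform_points_def)
  then show ?thesis
    using alpha_cut_K_limit_right[of \<alpha> u] alpha_cut_K_limit_left[OF u assms(2)]
      left_continuous_alpha_cut[OF u assms(2)] continuous_alpha_cut_iff[OF u assms(2,3)] assms(2)
    by auto
qed

end
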